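(* For every integer $r\ge1$, the segmental Lebesgue constant of the $r$ equidistant segments $\mathcal{S}^{\mathrm{eq}}$ of $I=[-1,1]$ satisfies $$\frac{1}{\pi}\,\frac{2^{r-1}}{r^2}\leq\Lambda_r(\mathcal{S}^{\mathrm{eq}})\leq r\,2^{r+4}.$$
   Context: The equidistant segments are $\mathcal{S}^{\mathrm{eq}}=\{s_1,\ldots,s_r\}$ with $s_i=[\xi_{i-1},\xi_i]$, where $\xi_i=-1+\frac{2i}{r}$, $i\in\{0,\ldots,r\}$. $\mathbb{P}_{r-1}$ is the space of real polynomials of degree at most $r-1$, and $\{\ell_{s_j}\}_{j=1}^r\subset\mathbb{P}_{r-1}$ is the Lagrange basis uniquely determined by $\int_{s_i}\ell_{s_j}(x)\,\mathrm{d}x=\delta_{ij}$ for $i,j\in\{1,\ldots,r\}$. The segmental Lebesgue constant is $\Lambda_r(\mathcal{S}^{\mathrm{eq}})=\sup_{x\in I}\sum_{i=1}^r|s_i|\,|\ell_{s_i}(x)|$, where $|s_i|=\frac2r$ is the length of $s_i$. *)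

theory Defs
  imports
    "HOL-Analysis.Analysis"
    "HOL-Computational_Algebra.Polynomial"
begin

definition equi_point :: "nat \<Rightarrow> nat \<Rightarrow> real" where
  "equi_point r i = - 1 + 2 * real i / real r"

definition equi_segment :: "nat \<Rightarrow> nat \<Rightarrow> real set" where
  "equi_segment r i = {equi_point r (i - 1)..equi_point r i}"

text \<open>A family \<open>s\<close> of \<open>r\<close> segments is indexed by \<open>{1..r}\<close>; values of \<open>s\<close> at other indices are ignored.\<close>

definition seg_lagrange :: "nat \<Rightarrow> (nat \<Rightarrow> real set) \<Rightarrow> nat \<Rightarrow> real poly" where
  "seg_lagrange r s j =
    (THE p. degree p \<le> r - 1 \<and>
       (\<forall>i\<in>{1..r}. integral (s i) (poly p) = (if i = j then 1 else 0)))"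

definition seg_lebesgue_const :: "nat \<Rightarrow> (nat \<Rightarrow> real set) \<Rightarrow> real" where
  "seg_lebesgue_const r s =
    (SUP x\<in>{-1..1}. \<Sum>i=1..r. measure lborel (s i) * \<bar>poly (seg_lagrange r s i) x\<bar>)"

end

theory Submission
  imports Defs
begin

text \<open>
  Rescale by $x = -1 + 2t/r$, so that the segments become $[i-1, i]$ in $[0, r]$. A function that
  integrates to 1 over the $j$-th segment and to 0 over the others has an antiderivative which
  jumps from 0 to 1 between the nodes $j-1$ and $j$ and has equal values at the ends of every other
  segment. Hence $|s_j|\,\ell_{s_j}$ is the derivative of the polynomial \<^term>\<open>step_poly r j\<close>
  that interpolates this unit step at $0, \dots, r$ (\<open>seg_lagrange_equi\<close>), and the Lebesgue
  constant is the supremum over $t \in [0, r]$ of the sum over $j$ of the absolute values of these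
  derivatives (\<open>lebesgue_function_equi\<close>).

  \<^emph>\<open>Upper bound.\<close> By Rolle, the derivative of the $j$-th step polynomial has a zero $\tau_i$ inside
  $(i-1, i)$ for each $i \neq j$. These are $r - 1$ zeros of a polynomial of degree at most $r - 1$,
  so the derivative equals its leading coefficient times $\prod_{i \neq j}(t - \tau_i)$
  (\<open>step_poly_deriv_factorization\<close>). The leading coefficient has absolute value
  $\binom{r-1}{j-1}/(r-1)!$ (\<open>lead_step_poly\<close>), and the product is at most $r!$ because
  for $t$ in the $m$-th segment each factor is at most $1 + |m - i|$. Summing
  $r\binom{r-1}{j-1}$ over $j$ gives the upper bound $r\,2^{r-1}$.

  \<^emph>\<open>Lower bound.\<close> Evaluate at $t = 0$. Consecutive step polynomials differ by one nodal Lagrange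
  basis polynomial, whose derivative at 0 is $\pm\binom{r}{k}/k$ (\<open>lagrange_basis_deriv_at_0\<close>).
  The triangle inequality therefore bounds twice the Lebesgue function at 0 from below by
  $\sum_k \binom{r}{k}/k \ge (2^r - 1)/r$.
\<close>

section \<open>Interpolation of a unit step at the integers\<close>

text \<open>The Lagrange basis for the nodes $0, \dots, r$. The usual denominators
  $\prod_{i \neq k}(k - i)$ are written in closed form, so that leading coefficients can be read off.\<close>

definition lagrange_basis :: "nat \<Rightarrow> nat \<Rightarrow> real poly" where
  "lagrange_basis r k = smult ((-1) ^ (r - k) / (fact k * fact (r - k)))
     (\<Prod>i\<in>{0..r} - {k}. [:- real i, 1:])"

definition step_poly :: "nat \<Rightarrow> nat \<Rightarrow> real poly" where
  "step_poly r j = (\<Sum>k=j..r. lagrange_basis r k)"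

lemma prod_node_differences:
  assumes "k \<le> r"
  shows "(\<Prod>i\<in>{0..r} - {k}. real k - real i) = (-1) ^ (r - k) * (fact k * fact (r - k))"
proof -
  have split: "{0..r} - {k} = {0..<k} \<union> {Suc k..r}"
    using assms by auto
  have low: "(\<Prod>i\<in>{0..<k}. real k - real i) = fact k"
  proof -
    have "(\<Prod>i\<in>{0..<k}. real k - real i) = (\<Prod>i\<in>{1..k}. real i)"
      by (rule prod.reindex_bij_witness[of _ "\<lambda>i. k - i" "\<lambda>i. k - i"]) (auto simp: of_nat_diff)
    then show ?thesis by (simp add: fact_prod)
  qed
  have high: "(\<Prod>i\<in>{Suc k..r}. real k - real i) = (-1) ^ (r - k) * fact (r - k)"
  proof -
    have "(\<Prod>i\<in>{Suc k..r}. real k - real i) = (\<Prod>i\<in>{1..r - k}. (-1) * real i)"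
      using assms
      by (intro prod.reindex_bij_witness[of _ "\<lambda>i. i + k" "\<lambda>i. i - k"]) (auto simp: of_nat_diff)
    also have "\<dots> = (-1) ^ (r - k) * (\<Prod>i\<in>{1..r - k}. real i)"
      by (subst prod.distrib) simp
    finally show ?thesis by (simp add: fact_prod)
  qed
  show ?thesis
    unfolding split by (subst prod.union_disjoint) (auto simp: low high)
qed

lemma poly_lagrange_basis_node:
  assumes "k \<le> r" "m \<le> r"
  shows "poly (lagrange_basis r k) (real m) = (if m = k then 1 else 0)"
proof (cases "m = k")
  case True
  then show ?thesis
    using prod_node_differences[OF assms(1)]
    by (simp add: lagrange_basis_def poly_prod power_mult_distrib[symmetric] flip: power2_eq_square power_mult_distrib)
next
  case False
  then have "(\<Prod>i\<in>{0..r} - {k}. real m - real i) = 0"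
    using assms by (intro prod_zero) auto
  then show ?thesis
    using False by (simp add: lagrange_basis_def poly_prod)
qed

lemma monic_prod_linear:
  assumes "finite A"
  shows "degree (\<Prod>a\<in>A. [:- f a, 1::real:]) = card A
    \<and> coeff (\<Prod>a\<in>A. [:- f a, 1::real:]) (card A) = 1"
proof -
  have deg: "degree (\<Prod>a\<in>A. [:- f a, 1::real:]) = card A"
    by (subst degree_prod_eq_sum_degree) auto
  moreover have "lead_coeff (\<Prod>a\<in>A. [:- f a, 1::real:]) = 1"
    by (simp add: lead_coeff_prod)
  ultimately show ?thesis by simp
qed

lemma degree_lead_lagrange_basis:
  assumes "k \<le> r"
  shows "degree (lagrange_basis r k) \<le> r"
    and "coeff (lagrange_basis r k) r = (-1) ^ (r - k) / (fact k * fact (r - k))"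
  using monic_prod_linear[of "{0..r} - {k}" real] assms
  by (auto simp: lagrange_basis_def)

lemma poly_step_poly_node:
  assumes "1 \<le> j" "j \<le> r" "m \<le> r"
  shows "poly (step_poly r j) (real m) = (if j \<le> m then 1 else 0)"
proof -
  have "poly (step_poly r j) (real m) = (\<Sum>k=j..r. if m = k then 1 else 0)"
    unfolding step_poly_def poly_sum using assms
    by (intro sum.cong refl) (simp add: poly_lagrange_basis_node)
  then show ?thesis using assms by (simp add: sum.delta)
qed

lemma degree_step_poly: "degree (step_poly r j) \<le> r"
  unfolding step_poly_def by (intro degree_sum_le) (auto simp: degree_lead_lagrange_basis)

text \<open>By Pascal's rule $\binom{r}{k} = \binom{r-1}{k-1} + \binom{r-1}{k}$ the alternating sum
  telescopes.\<close>

lemma alternating_upper_choose_sum: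
  assumes "1 \<le> j" "j \<le> r"
  shows "(\<Sum>k=j..r. (-1) ^ (r - k) * real (r choose k)) = (-1) ^ (r - j) * real ((r - 1) choose (j - 1))"
  using assms(2,1)
proof (induction rule: inc_induct)
  case base
  then show ?case by simp
next
  case (step j)
  have pascal: "real (r choose j) = real ((r - 1) choose (j - 1)) + real ((r - 1) choose j)"
    using step by (metis choose_reduce_nat le_less_trans less_eq_Suc_le of_nat_add
        One_nat_def Suc_le_lessD zero_le)
  have pow: "(-1::real) ^ (r - j) = - ((-1) ^ (r - Suc j))"
    using step by (metis Suc_diff_Suc mult_minus1 power_Suc)
  have "(\<Sum>k=j..r. (-1) ^ (r - k) * real (r choose k))
      = (-1) ^ (r - j) * real (r choose j) + (\<Sum>k=Suc j..r. (-1) ^ (r - k) * real (r choose k))"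
    using step by (subst sum.atLeast_Suc_atMost) auto
  also have "\<dots> = (-1) ^ (r - j) * real (r choose j) + (-1) ^ (r - Suc j) * real ((r - 1) choose j)"
    using step by simp
  finally show ?case
    unfolding pascal pow by (simp add: algebra_simps)
qed

lemma lead_step_poly:
  assumes "1 \<le> j" "j \<le> r"
  shows "\<bar>coeff (step_poly r j) r\<bar> = real ((r - 1) choose (j - 1)) / fact r"
proof -
  have "coeff (step_poly r j) r = (\<Sum>k=j..r. (-1) ^ (r - k) * real (r choose k) / fact r)"
    unfolding step_poly_def coeff_sum
    by (intro sum.cong refl) (simp add: degree_lead_lagrange_basis binomial_fact)
  also have "\<dots> = (-1) ^ (r - j) * real ((r - 1) choose (j - 1)) / fact r"
    by (simp only: sum_divide_distrib[symmetric] alternating_upper_choose_sum[OF assms])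
  finally show ?thesis by (simp add: abs_mult)
qed

section \<open>Upper bound for the sum of the derivatives\<close>

lemma step_poly_deriv_zero:
  assumes "1 \<le> j" "j \<le> r" "i \<in> {1..r} - {j}"
  shows "\<exists>z. real i - 1 < z \<and> z < real i \<and> poly (pderiv (step_poly r j)) z = 0"
proof -
  have "poly (step_poly r j) (real (i - 1)) = poly (step_poly r j) (real i)"
    using assms by (subst (1 2) poly_step_poly_node) auto
  then have eq: "poly (step_poly r j) (real i - 1) = poly (step_poly r j) (real i)"
    using assms by (simp add: of_nat_diff)
  obtain z where "real i - 1 < z" "z < real i"
      "poly (step_poly r j) (real i) - poly (step_poly r j) (real i - 1)
        = (real i - (real i - 1)) * poly (pderiv (step_poly r j)) z"
    using poly_MVT[of "real i - 1" "real i" "step_poly r j"] by auto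
  with eq show ?thesis by auto
qed

text \<open>The zeros from Rolle's theorem lie in disjoint open intervals, hence are distinct, and
  there are as many of them as the degree allows. So the derivative is known up to the location of
  each zero within its interval, which is all that the size estimate uses.\<close>

lemma step_poly_deriv_factorization:
  assumes "1 \<le> j" "j \<le> r"
  obtains \<tau> where "\<And>i. i \<in> {1..r} - {j} \<Longrightarrow> real i - 1 < \<tau> i \<and> \<tau> i < real i"
    and "pderiv (step_poly r j) =
      smult (real r * coeff (step_poly r j) r) (\<Prod>i\<in>{1..r} - {j}. [:- \<tau> i, 1:])"
proof -
  let ?I = "{1..r} - {j}" and ?p = "pderiv (step_poly r j)"
  have "\<forall>i\<in>?I. \<exists>z. real i - 1 < z \<and> z < real i \<and> poly ?p z = 0"
    using step_poly_deriv_zero[OF assms] by blast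
  then obtain \<tau> where \<tau>: "\<And>i. i \<in> ?I \<Longrightarrow> real i - 1 < \<tau> i \<and> \<tau> i < real i \<and> poly ?p (\<tau> i) = 0"
    by metis
  have inj: "inj_on \<tau> ?I"
  proof (rule linorder_inj_onI)
    fix a b assume "a < b" "a \<in> ?I" "b \<in> ?I"
    then have "\<tau> a < real a" "real b - 1 < \<tau> b" "real a \<le> real b - 1"
      using \<tau>[of a] \<tau>[of b] by auto
    then show "\<tau> a \<noteq> \<tau> b" by linarith
  qed auto
  have card: "card ?I = r - 1" "card (\<tau> ` ?I) = r - 1"
    using assms inj by (auto simp: card_image)
  let ?q = "\<Prod>i\<in>?I. [:- \<tau> i, 1:]"
  have q: "degree ?q = r - 1" "coeff ?q (r - 1) = 1"
    using monic_prod_linear[of ?I \<tau>] card by auto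
  have "?p = smult (real r * coeff (step_poly r j) r) ?q"
  proof (rule poly_eqI_degree_lead_coeff[where n = "r - 1" and A = "\<tau> ` ?I"])
    show "coeff ?p (r - 1) = coeff (smult (real r * coeff (step_poly r j) r) ?q) (r - 1)"
      using assms q by (simp add: coeff_pderiv)
    show "degree ?p \<le> r - 1"
      using degree_step_poly[of r j] by (simp add: degree_pderiv)
    show "degree (smult (real r * coeff (step_poly r j) r) ?q) \<le> r - 1"
      using q by (simp add: degree_smult_eq)
  next
    fix z assume "z \<in> \<tau> ` ?I"
    then obtain i where i: "i \<in> ?I" "z = \<tau> i" by blast
    then have "poly ?q z = 0"
      unfolding poly_prod by (intro prod_zero bexI[of _ i]) auto
    then show "poly ?p z = poly (smult (real r * coeff (step_poly r j) r) ?q) z"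
      using \<tau>[OF i(1)] i(2) by simp
  qed (use card in simp)
  then show ?thesis using that \<tau> by blast
qed

text \<open>For $a, b' \ge 1$ this is $a!\,b'! \le (a + b' - 1)!$ with $b' = b + 1$.\<close>

lemma fact_mult_fact_le:
  "1 \<le> a \<Longrightarrow> fact a * fact (Suc b) \<le> (fact (a + b) :: nat)"
proof (induction b)
  case (Suc b)
  have "fact a * fact (Suc (Suc b)) = fact a * fact (Suc b) * (Suc (Suc b))"
    by (simp only: fact_Suc mult_ac of_nat_id)
  also have "\<dots> \<le> fact (a + b) * (a + Suc b)"
    using Suc by (intro mult_mono) auto
  also have "\<dots> = fact (a + Suc b)" by (simp add: algebra_simps)
  finally show ?case .
qed auto

text \<open>The factors up to $m$ multiply to $m!$ and those after $m$ to $(r - m + 1)!$.\<close>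

lemma prod_distance_bound:
  assumes "m \<in> {1..r}"
  shows "(\<Prod>i\<in>{1..r}. 1 + \<bar>real m - real i\<bar>) \<le> fact r"
proof -
  have low: "(\<Prod>i\<in>{1..m}. 1 + \<bar>real m - real i\<bar>) = fact m"
  proof -
    have "(\<Prod>i\<in>{1..m}. 1 + \<bar>real m - real i\<bar>) = (\<Prod>i\<in>{1..m}. real i)"
      by (rule prod.reindex_bij_witness[of _ "\<lambda>i. Suc m - i" "\<lambda>i. Suc m - i"]) (auto simp: of_nat_diff)
    then show ?thesis by (simp add: fact_prod)
  qed
  have high: "(\<Prod>i\<in>{Suc m..r}. 1 + \<bar>real m - real i\<bar>) = fact (Suc (r - m))"
  proof -
    have "(\<Prod>i\<in>{Suc m..r}. 1 + \<bar>real m - real i\<bar>) = (\<Prod>i\<in>{2..Suc (r - m)}. real i)"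
      using assms
      by (intro prod.reindex_bij_witness[of _ "\<lambda>i. i + m - 1" "\<lambda>i. Suc i - m"]) (auto simp: of_nat_diff)
    also have "\<dots> = (\<Prod>i\<in>{1..Suc (r - m)}. real i)"
      by (subst (2) prod.atLeast_Suc_atMost) (auto simp: numeral_2_eq_2)
    finally show ?thesis by (simp only: fact_prod of_nat_prod)
  qed
  have "{1..r} = {1..m} \<union> {Suc m..r}" using assms by auto
  then have "(\<Prod>i\<in>{1..r}. 1 + \<bar>real m - real i\<bar>) = fact m * fact (Suc (r - m))"
    by (simp only: low[symmetric] high[symmetric]) (subst prod.union_disjoint, auto)
  also have "\<dots> = real (fact m * fact (Suc (r - m)))" by (simp del: fact_Suc)
  also have "\<dots> \<le> real (fact (m + (r - m)))"
    using assms fact_mult_fact_le[of m "r - m"] by (intro of_nat_mono) auto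
  finally show ?thesis using assms by simp
qed

lemma step_poly_deriv_bound:
  assumes "1 \<le> j" "j \<le> r" "0 \<le> t" "t \<le> real r"
  shows "\<bar>poly (pderiv (step_poly r j)) t\<bar> \<le> real r * real ((r - 1) choose (j - 1))"
proof -
  obtain \<tau> where \<tau>: "\<And>i. i \<in> {1..r} - {j} \<Longrightarrow> real i - 1 < \<tau> i \<and> \<tau> i < real i"
    and fac: "pderiv (step_poly r j) =
      smult (real r * coeff (step_poly r j) r) (\<Prod>i\<in>{1..r} - {j}. [:- \<tau> i, 1:])"
    using step_poly_deriv_factorization[OF assms(1,2)] by blast
  obtain m where m: "m \<in> {1..r}" "real m - 1 \<le> t" "t \<le> real m"
  proof (cases "t = 0")
    case True
    then show ?thesis using that[of 1] assms by auto
  next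
    case False
    show ?thesis
    proof (rule that[of "nat \<lceil>t\<rceil>"])
      show "nat \<lceil>t\<rceil> \<in> {1..r}"
        using False assms by (auto simp: nat_le_iff ceiling_le_iff le_nat_iff)
      show "real (nat \<lceil>t\<rceil>) - 1 \<le> t" "t \<le> real (nat \<lceil>t\<rceil>)"
        using assms by linarith+
    qed
  qed
  have "(\<Prod>i\<in>{1..r} - {j}. \<bar>t - \<tau> i\<bar>) \<le> (\<Prod>i\<in>{1..r} - {j}. 1 + \<bar>real m - real i\<bar>)"
  proof (rule prod_mono, safe)
    fix i assume "i \<in> {1..r}" "i \<noteq> j"
    then have "real i - 1 < \<tau> i" "\<tau> i < real i" using \<tau>[of i] by auto
    then show "\<bar>t - \<tau> i\<bar> \<le> 1 + \<bar>real m - real i\<bar>" using m by linarith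
  qed auto
  \<comment> \<open>Inserting the missing factor for $j$ costs nothing, since all factors are at least 1.\<close>
  also have "\<dots> \<le> (\<Prod>i\<in>{1..r}. 1 + \<bar>real m - real i\<bar>)"
    by (rule prod_mono2) auto
  also have "\<dots> \<le> fact r" by (rule prod_distance_bound[OF m(1)])
  finally have "(\<Prod>i\<in>{1..r} - {j}. \<bar>t - \<tau> i\<bar>) \<le> fact r" .
  then have "real r * (real ((r - 1) choose (j - 1)) / fact r) * (\<Prod>i\<in>{1..r} - {j}. \<bar>t - \<tau> i\<bar>)
      \<le> real r * (real ((r - 1) choose (j - 1)) / fact r) * fact r"
    by (intro mult_left_mono) auto
  moreover have "\<bar>poly (pderiv (step_poly r j)) t\<bar>
      = real r * (real ((r - 1) choose (j - 1)) / fact r) * (\<Prod>i\<in>{1..r} - {j}. \<bar>t - \<tau> i\<bar>)"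
    by (simp add: fac abs_mult lead_step_poly[OF assms(1,2), simplified] poly_prod abs_prod)
  ultimately show ?thesis by simp
qed

lemma step_poly_deriv_sum_bound:
  assumes "1 \<le> r" "0 \<le> t" "t \<le> real r"
  shows "(\<Sum>j=1..r. \<bar>poly (pderiv (step_poly r j)) t\<bar>) \<le> real r * 2 ^ (r - 1)"
proof -
  have "(\<Sum>j=1..r. \<bar>poly (pderiv (step_poly r j)) t\<bar>)
      \<le> (\<Sum>j=1..r. real r * real ((r - 1) choose (j - 1)))"
    using assms by (intro sum_mono step_poly_deriv_bound) auto
  also have "\<dots> = real r * real (\<Sum>j=1..r. (r - 1) choose (j - 1))"
    by (simp add: sum_distrib_left)
  also have "(\<Sum>j=1..r. (r - 1) choose (j - 1)) = (\<Sum>j\<le>r - 1. (r - 1) choose j)"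
    using assms(1) by (intro sum.reindex_bij_witness[of _ Suc "\<lambda>j. j - 1"]) auto
  finally show ?thesis by (simp add: choose_row_sum)
qed

section \<open>Lower bound at the left end point\<close>

text \<open>The node 0 contributes the factor $t$, so the derivative at 0 is the value there of the
  product of the remaining factors.\<close>

lemma lagrange_basis_deriv_at_0:
  assumes "1 \<le> k" "k \<le> r"
  shows "\<bar>poly (pderiv (lagrange_basis r k)) 0\<bar> = real (r choose k) / real k"
proof -
  let ?q = "\<Prod>i\<in>{1..r} - {k}. [:- real i, 1:]"
  have "{0..r} - {k} = insert 0 ({1..r} - {k})" using assms by auto
  then have "(\<Prod>i\<in>{0..r} - {k}. [:- real i, 1:]) = [:0, 1:] * ?q"
    by simp
  then have "poly (pderiv (lagrange_basis r k)) 0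
      = (-1) ^ (r - k) / (fact k * fact (r - k)) * poly ?q 0"
    by (simp add: lagrange_basis_def pderiv_smult pderiv_mult pderiv_pCons)
  moreover have "\<bar>poly ?q 0\<bar> = (\<Prod>i\<in>{1..r} - {k}. real i)"
    by (simp add: poly_prod abs_prod)
  moreover have "\<dots> = fact r / real k"
    using assms by (subst prod_diff1) (auto simp: fact_prod)
  ultimately show ?thesis
    using assms by (simp add: abs_mult binomial_fact)
qed

text \<open>Each derivative $g_j$ of a step polynomial at 0 occurs in at most two of the differences
  $g_j - g_{j+1} = \pm\binom{r}{j}/j$; this is the source of the factor 2.\<close>

lemma step_poly_deriv_sum_at_0:
  assumes "1 \<le> r"
  shows "2 ^ (r - 1) / (2 * real r) \<le> (\<Sum>j=1..r. \<bar>poly (pderiv (step_poly r j)) 0\<bar>)"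
proof -
  define g where "g j = poly (pderiv (step_poly r j)) 0" for j
  have gr: "g (Suc r) = 0" by (simp add: g_def step_poly_def)
  have tel: "real (r choose j) / real j \<le> \<bar>g j\<bar> + \<bar>g (Suc j)\<bar>" if "j \<in> {1..r}" for j
  proof -
    have "step_poly r j = lagrange_basis r j + step_poly r (Suc j)"
      using that unfolding step_poly_def by (subst sum.atLeast_Suc_atMost) auto
    then have "poly (pderiv (lagrange_basis r j)) 0 = g j - g (Suc j)"
      by (simp add: g_def pderiv_add)
    then show ?thesis
      using lagrange_basis_deriv_at_0[of j r] that by simp
  qed
  have shift: "(\<Sum>j=1..r. \<bar>g (Suc j)\<bar>) \<le> (\<Sum>j=1..r. \<bar>g j\<bar>)"
  proof -
    have "(\<Sum>j=1..r. \<bar>g (Suc j)\<bar>) = (\<Sum>j\<in>{2..Suc r}. \<bar>g j\<bar>)"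
      by (rule sum.reindex_bij_witness[of _ "\<lambda>j. j - 1" Suc]) auto
    also have "\<dots> = (\<Sum>j\<in>{2..r}. \<bar>g j\<bar>)"
      using assms gr by (subst sum.atLeastAtMost_rev, subst sum.atLeastAtMost_rev) (simp_all)
    also have "\<dots> \<le> (\<Sum>j=1..r. \<bar>g j\<bar>)" by (rule sum_mono2) auto
    finally show ?thesis .
  qed
  have "(2::real) ^ (r - 1) \<le> 2 ^ r - 1"
    using assms by (cases r) (auto simp: one_le_power)
  also have "(2::real) ^ r - 1 = (\<Sum>j=1..r. real (r choose j))"
  proof -
    have "(\<Sum>j\<le>r. r choose j) = 1 + (\<Sum>j=1..r. r choose j)"
      by (simp add: atMost_atLeast0 sum.atLeast_Suc_atMost)
    then have "(2::nat) ^ r = 1 + (\<Sum>j=1..r. r choose j)" by (simp only: choose_row_sum)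
    then have "real (2 ^ r) = real (1 + (\<Sum>j=1..r. r choose j))" by presburger
    then show ?thesis by simp
  qed
  finally have "2 ^ (r - 1) / real r \<le> (\<Sum>j=1..r. real (r choose j)) / real r"
    by (intro divide_right_mono) auto
  also have "\<dots> \<le> (\<Sum>j=1..r. real (r choose j) / real j)"
    unfolding sum_divide_distrib by (intro sum_mono divide_left_mono) auto
  also have "\<dots> \<le> (\<Sum>j=1..r. \<bar>g j\<bar> + \<bar>g (Suc j)\<bar>)" by (intro sum_mono tel)
  also have "\<dots> \<le> 2 * (\<Sum>j=1..r. \<bar>g j\<bar>)" using shift by (simp add: sum.distrib)
  finally show ?thesis by (simp add: g_def field_simps)
qed

section \<open>The segmental Lagrange basis of the equidistant segments\<close>

lemma poly_zero_of_integral_zero: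
  fixes p :: "real poly"
  assumes "a < b" "integral {a..b} (poly p) = 0"
  shows "\<exists>z. a < z \<and> z < b \<and> poly p z = 0"
proof -
  have cont: "continuous_on {a..b} (poly p)" by (intro continuous_intros)
  let ?F = "\<lambda>x. integral {a..x} (poly p)"
  have der: "(?F has_real_derivative poly p x) (at x within {a..b})" if "x \<in> {a..b}" for x
    by (rule integral_has_real_derivative[OF cont that])
  have "\<exists>z>a. z < b \<and> (\<lambda>v. poly p z * v) = (\<lambda>v. 0)"
  proof (rule Rolle_deriv[OF assms(1)])
    show "?F a = ?F b" using assms by simp
    show "continuous_on {a..b} ?F"
      by (rule indefinite_integral_continuous_1) (rule integrable_continuous_real[OF cont])
    fix x assume x: "a < x" "x < b"
    then have "(?F has_real_derivative poly p x) (at x)"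
      using der[of x] by (simp add: at_within_Icc_at)
    then show "(?F has_derivative (\<lambda>v. poly p x * v)) (at x)"
      by (simp add: has_field_derivative_def)
  qed
  then show ?thesis by (auto simp: fun_eq_iff)
qed

lemma equi_point_less: "1 \<le> r \<Longrightarrow> 1 \<le> i \<Longrightarrow> equi_point r (i - 1) < equi_point r i"
  by (simp add: equi_point_def divide_strict_right_mono)

lemma equi_point_mono: "i \<le> j \<Longrightarrow> equi_point r i \<le> equi_point r j"
  by (simp add: equi_point_def divide_right_mono)

text \<open>Uniqueness of segmental interpolation: a vanishing integral forces a zero inside each of
  the $r$ segments, too many for a nonzero polynomial of degree below $r$.\<close>

lemma poly_zero_of_segment_integrals_zero:
  fixes p :: "real poly"
  assumes "1 \<le> r" "degree p \<le> r - 1"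
    and "\<And>i. i \<in> {1..r} \<Longrightarrow> integral (equi_segment r i) (poly p) = 0"
  shows "p = 0"
proof -
  have "\<exists>z. equi_point r (i - 1) < z \<and> z < equi_point r i \<and> poly p z = 0" if "i \<in> {1..r}" for i
    using assms(1) that assms(3)[OF that] unfolding equi_segment_def
    by (intro poly_zero_of_integral_zero equi_point_less) auto
  then obtain \<tau> where \<tau>: "\<And>i. i \<in> {1..r} \<Longrightarrow>
      equi_point r (i - 1) < \<tau> i \<and> \<tau> i < equi_point r i \<and> poly p (\<tau> i) = 0"
    by metis
  have inj: "inj_on \<tau> {1..r}"
  proof (rule linorder_inj_onI)
    fix a b assume *: "a < b" "a \<in> {1..r}" "b \<in> {1..r}"
    have "equi_point r a \<le> equi_point r (b - 1)" using * by (intro equi_point_mono) auto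
    then show "\<tau> a \<noteq> \<tau> b" using \<tau>[OF *(2)] \<tau>[OF *(3)] by linarith
  qed auto
  show ?thesis
    by (rule poly_eqI_degree[of "\<tau> ` {1..r}"]) (use \<tau> assms inj in \<open>auto simp: card_image\<close>)
qed

lemma integral_pderiv:
  fixes p :: "real poly"
  assumes "a \<le> b"
  shows "integral {a..b} (poly (pderiv p)) = poly p b - poly p a"
  by (intro integral_unique fundamental_theorem_of_calculus[OF assms])
     (auto simp flip: has_real_derivative_iff_has_vector_derivative
           intro: has_field_derivative_at_within poly_DERIV)

text \<open>The polynomial \<^term>\<open>[:real r / 2, real r / 2:]\<close> is the affine map $x \mapsto (x+1)r/2$
  that sends the $i$-th end point to $i$.\<close>

lemma seg_lagrange_equi:
  assumes "1 \<le> r" "j \<in> {1..r}"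
  shows "seg_lagrange r (equi_segment r) j
    = pderiv (pcompose (step_poly r j) [:real r / 2, real r / 2:])"
    (is "_ = pderiv ?P")
proof -
  have node: "poly ?P (equi_point r m) = (if j \<le> m then 1 else 0)" if "m \<le> r" for m
  proof -
    have "real r / 2 + equi_point r m * (real r / 2) = real m"
      using assms(1) by (simp add: equi_point_def field_simps)
    then show ?thesis using that assms by (simp add: poly_pcompose poly_step_poly_node)
  qed
  have int: "integral (equi_segment r i) (poly (pderiv ?P)) = (if i = j then 1 else 0)"
    if "i \<in> {1..r}" for i
    using that assms unfolding equi_segment_def
    by (subst integral_pderiv) (auto simp: node intro: equi_point_mono)
  have deg: "degree (pderiv ?P) \<le> r - 1"
    using degree_step_poly[of r j] assms(1) by (simp add: degree_pderiv degree_pcompose)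
  show ?thesis
    unfolding seg_lagrange_def
  proof (rule the_equality)
    fix q assume q: "degree q \<le> r - 1 \<and>
      (\<forall>i\<in>{1..r}. integral (equi_segment r i) (poly q) = (if i = j then 1 else 0))"
    have "q - pderiv ?P = 0"
    proof (rule poly_zero_of_segment_integrals_zero[OF assms(1)])
      show "degree (q - pderiv ?P) \<le> r - 1" using q deg by (intro degree_diff_le) auto
      fix i assume i: "i \<in> {1..r}"
      have "poly (q - pderiv ?P) = (\<lambda>x. poly q x - poly (pderiv ?P) x)" by auto
      moreover have "integral (equi_segment r i) (\<lambda>x. poly q x - poly (pderiv ?P) x)
          = integral (equi_segment r i) (poly q) - integral (equi_segment r i) (poly (pderiv ?P))"
        unfolding equi_segment_def
        by (intro Henstock_Kurzweil_Integration.integral_diff integrable_continuous_real continuous_intros)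
      ultimately show "integral (equi_segment r i) (poly (q - pderiv ?P)) = 0"
        using q int[OF i] i by simp
    qed
    then show "q = pderiv ?P" by simp
  qed (use deg int in auto)
qed

text \<open>The length $2/r$ of a segment cancels the inner derivative $r/2$ of the change of
  variable.\<close>

lemma lebesgue_function_equi:
  assumes "1 \<le> r"
  shows "(\<Sum>i=1..r. measure lborel (equi_segment r i) * \<bar>poly (seg_lagrange r (equi_segment r) i) x\<bar>)
    = (\<Sum>j=1..r. \<bar>poly (pderiv (step_poly r j)) (real r / 2 + x * (real r / 2))\<bar>)"
proof (intro sum.cong refl)
  fix i assume i: "i \<in> {1..r}"
  have "measure lborel (equi_segment r i) = 2 / real r"
    using i assms equi_point_less[of r i]
    by (simp add: equi_segment_def, simp add: equi_point_def of_nat_diff field_simps)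
  then show "measure lborel (equi_segment r i) * \<bar>poly (seg_lagrange r (equi_segment r) i) x\<bar>
    = \<bar>poly (pderiv (step_poly r i)) (real r / 2 + x * (real r / 2))\<bar>"
    using assms i
    by (simp add: seg_lagrange_equi pderiv_pcompose poly_pcompose pderiv_pCons abs_mult)
qed

theorem mainTheorem5:
  fixes r :: nat
  assumes "r \<ge> 1"
  shows "1 / pi * (2 ^ (r - 1) / (real r)\<^sup>2) \<le> seg_lebesgue_const r (equi_segment r)
    \<and> seg_lebesgue_const r (equi_segment r) \<le> real r * 2 ^ (r + 4)"
proof -
  define L where "L x = (\<Sum>j=1..r. \<bar>poly (pderiv (step_poly r j)) (real r / 2 + x * (real r / 2))\<bar>)" for x
  have const: "seg_lebesgue_const r (equi_segment r) = (SUP x\<in>{-1..1}. L x)"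
    unfolding seg_lebesgue_const_def L_def lebesgue_function_equi[OF assms] ..
  have upper: "L x \<le> real r * 2 ^ (r - 1)" if "x \<in> {-1..1}" for x
  proof -
    have eq: "real r / 2 + x * (real r / 2) = (1 + x) * (real r / 2)" by (simp add: algebra_simps)
    have "(1 + x) * (real r / 2) \<le> 2 * (real r / 2)"
      using that by (intro mult_right_mono) auto
    then show ?thesis
      using that unfolding L_def eq by (intro step_poly_deriv_sum_bound[OF assms]) auto
  qed
  have "(SUP x\<in>{-1..1}. L x) \<le> real r * 2 ^ (r - 1)"
    by (rule cSUP_least[OF _ upper]) auto
  also have "\<dots> \<le> real r * 2 ^ (r + 4)"
    by (intro mult_left_mono power_increasing) auto
  finally have le: "(SUP x\<in>{-1..1}. L x) \<le> real r * 2 ^ (r + 4)" .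
  have pi_r: "2 * real r \<le> pi * (real r)\<^sup>2"
  proof -
    have "2 * real r \<le> pi * real r" using pi_ge_two by (intro mult_right_mono) auto
    also have "\<dots> \<le> pi * (real r)\<^sup>2"
      using assms by (intro mult_left_mono) (auto simp: power2_eq_square)
    finally show ?thesis .
  qed
  have "1 / pi * (2 ^ (r - 1) / (real r)\<^sup>2) = 2 ^ (r - 1) / (pi * (real r)\<^sup>2)" by simp
  also have "\<dots> \<le> 2 ^ (r - 1) / (2 * real r)"
    using pi_r assms by (intro divide_left_mono) auto
  also have "\<dots> \<le> L (-1)"
    using step_poly_deriv_sum_at_0[OF assms] by (simp add: L_def)
  also have "\<dots> \<le> (SUP x\<in>{-1..1}. L x)"
    by (rule cSUP_upper) (auto intro!: bdd_aboveI2[where M = "real r * 2 ^ (r - 1)"] upper)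
  finally show ?thesis using le const by simp
qed

end
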